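(* For a positive integer $n$ and a positive integer $k$, let $A_k(n)$ denote the number of integers $a$ with $1 \leq a \leq n$ for which there exist positive integers $m_1 \leq m_2 \leq \dotsb \leq m_k$ such that $$\frac{a}{n} = \frac{1}{m_1} + \frac{1}{m_2} + \dotsb + \frac{1}{m_k}.$$ Then for every integer $k \geq 2$, $$A_k(n) \leq n^{1 - 1/2^{k-2} + o(1)}$$ as $n \to \infty$; that is, for every $\varepsilon > 0$ there is $N$ such that $A_k(n) \leq n^{1 - 1/2^{k-2} + \varepsilon}$ for all $n \geq N$. *)

theory Defs
  imports Complex_Main
begin

definition egyptian_count :: "nat \<Rightarrow> nat \<Rightarrow> nat" where
  "egyptian_count k n =
     card {a \<in> {1..n}. \<exists>m :: nat \<Rightarrow> nat.
        (\<forall>i\<in>{1..k}. m i > 0) \<and>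
        (\<forall>i\<in>{1..k}. \<forall>j\<in>{1..k}. i \<le> j \<longrightarrow> m i \<le> m j) \<and>
        (of_nat a / of_nat n :: rat) = (\<Sum>i=1..k. 1 / of_nat (m i))}"

end

theory Submission
  imports Defs "HOL-Library.FuncSet" "HOL-Computational_Algebra.Primes"
begin

text \<open>
  Put \<open>T = n^(1/2^(k-2))\<close> and compare \<open>m_i\<close> with the threshold \<open>T^(2^(i-1))\<close> for \<open>i \<le> k - 2\<close>.
  If \<open>j\<close> is the first index with \<open>m_j\<close> above its threshold, there are at most \<open>T^(2^(j-1)-1)\<close>
  choices for \<open>m_1, \<dots>, m_{j-1}\<close>, and each confines \<open>a\<close> to an interval of length
  \<open>k n / T^(2^(j-1))\<close>, which gives \<open>O(n/T)\<close> values of \<open>a\<close>. If no threshold is exceeded, there are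
  at most \<open>n/T\<close> tuples \<open>m_1, \<dots>, m_{k-2}\<close>, and what is left is \<open>b/N = 1/x + 1/y\<close> with \<open>N \<le> n^2\<close>.
  Writing \<open>x = g u\<close> and \<open>y = g v\<close> with \<open>u, v\<close> coprime, one finds that \<open>u v\<close> divides \<open>N\<close> and \<open>b\<close>
  divides \<open>(N/(u v)) (u + v)\<close>, so the divisor bound leaves only \<open>n^o(1)\<close> values of \<open>b\<close>.
\<close>

section \<open>The divisor bound\<close>

text \<open>Every divisor of \<open>p ^ a * m\<close> factors as \<open>p ^ i\<close> with
  \<open>i \<le> a\<close> times a divisor of \<open>m\<close>. An upper bound needs only this
  surjection, not uniqueness of the factorisation.\<close>

lemma card_divisors_prime_power_mult_le:
  fixes p m a :: nat
  assumes "prime p" "m > 0"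
  shows "card {d. d dvd p ^ a * m} \<le> (a + 1) * card {d. d dvd m}"
proof -
  have "{d. d dvd p ^ a * m} \<subseteq> (\<lambda>(i, d). p ^ i * d) ` ({..a} \<times> {d. d dvd m})"
  proof
    fix d assume "d \<in> {d. d dvd p ^ a * m}"
    then obtain b c where bc: "d = b * c" "b dvd p ^ a" "c dvd m"
      using division_decomp by blast
    with assms obtain i where "i \<le> a" "b = p ^ i"
      using divides_primepow_nat by blast
    with bc show "d \<in> (\<lambda>(i, d). p ^ i * d) ` ({..a} \<times> {d. d dvd m})"
      by auto
  qed
  then have "card {d. d dvd p ^ a * m} \<le> card ({..a} \<times> {d. d dvd m})"
    using assms by (intro surj_card_le) auto
  then show ?thesis
    by (simp add: card_cartesian_product)
qed

text \<open>The estimate for small primes: \<open>1 + t \<le> exp t\<close> bounds the linear count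
  by an exponential, at the price of a constant factor that depends on \<open>e\<close>
  alone.\<close>

lemma Suc_le_powr_const:
  fixes e x :: real and a :: nat
  assumes "e > 0" "x \<ge> 2"
  shows "real a + 1 \<le> (1 + 1 / (e * ln 2)) * (x ^ a) powr e"
proof -
  \<comment> \<open>This choice makes \<open>exp (a * c)\<close> equal to
    \<open>(2 ^ a) powr e\<close>.\<close>
  define c where "c = e * ln 2"
  have c: "c > 0" using assms by (simp add: c_def)
  have "real a + 1 \<le> (1 + 1 / c) * (1 + real a * c)"
    using c by (simp add: field_simps add_nonneg_nonneg)
  also have "\<dots> \<le> (1 + 1 / c) * exp (real a * c)"
    using c by (intro mult_left_mono exp_ge_add_one_self) (auto intro: add_nonneg_nonneg)
  also have "exp (real a * c) = (2 ^ a) powr e"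
    by (simp add: c_def powr_def ln_realpow mult_ac)
  also have "(2 ^ a) powr e \<le> (x ^ a) powr e"
    using assms by (intro powr_mono2 power_mono) auto
  finally show ?thesis using c by (simp add: c_def mult_left_mono)
qed

text \<open>The estimate for large primes: here \<open>x powr e \<ge> 2\<close>, and
  \<open>a + 1 \<le> 2 ^ a\<close>, so no constant is lost.\<close>

lemma Suc_le_powr:
  fixes e x :: real and a :: nat
  assumes "e > 0" "x \<ge> 2 powr (1 / e)"
  shows "real a + 1 \<le> (x ^ a) powr e"
proof -
  have x: "x > 0" using assms(2) by (smt (verit) powr_gt_zero)
  have "2 = (2 powr (1 / e)) powr e"
    using assms by (simp add: powr_powr)
  also have "\<dots> \<le> x powr e"
    using assms by (intro powr_mono2) auto
  finally have "2 ^ a \<le> (x powr e) ^ a"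
    by (intro power_mono) auto
  also have "(x powr e) ^ a = (x ^ a) powr e"
    using x by (simp add: powr_power powr_realpow[symmetric] powr_powr mult_ac)
  finally show ?thesis
    using of_nat_mono[OF less_exp[of a, unfolded Suc_le_eq[symmetric]], where 'a = real] by simp
qed

text \<open>Induction on \<open>n\<close>, splitting off the full power of one prime
  \<open>p\<close>. Since \<open>g\<close> depends on the prime and not on its exponent, each
  distinct prime contributes its factor exactly once.\<close>

lemma card_divisors_le_prod:
  fixes n :: nat and e B :: real and g :: "nat \<Rightarrow> real"
  assumes "n > 0"
    and g: "\<And>p a. prime p \<Longrightarrow> real a + 1 \<le> g p * (real p ^ a) powr e"
    and g0: "\<And>p. g p \<ge> 0"
  shows "real (card {d. d dvd n}) \<le> (\<Prod>p\<in>prime_factors n. g p) * real n powr e"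
  using \<open>n > 0\<close>
proof (induction n rule: less_induct)
  case (less n)
  show ?case
  proof (cases "n = 1")
    case True
    then show ?thesis by simp
  next
    case False
    then obtain p where p: "prime p" "p dvd n"
      using prime_factor_nat by blast
    define a where "a = multiplicity p n"
    obtain m where m: "n = p ^ a * m" "\<not> p dvd m"
      using multiplicity_decompose'[of n p] p less.prems unfolding a_def
      by (metis not_prime_unit not_gr_zero)
    have a: "a > 0"
      using m p by (cases a) auto
    have m0: "m > 0" using m by (cases m) auto
    have "p ^ a > 1"
      using a p prime_gt_1_nat by (metis one_less_power)
    then have "m < n" using m m0 by simp
    from less.IH[OF this m0]
    have IH: "real (card {d. d dvd m}) \<le> (\<Prod>p\<in>prime_factors m. g p) * real m powr e" .
    have pf: "prime_factors n = insert p (prime_factors m)"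
      using m(1) m0 a p
      by (auto simp: in_prime_factors_iff prime_dvd_mult_iff prime_dvd_power_iff primes_dvd_imp_eq)
    have pn: "p \<notin> prime_factors m" using m by auto
    have "real (card {d. d dvd n}) \<le> (real a + 1) * real (card {d. d dvd m})"
      using of_nat_mono[OF card_divisors_prime_power_mult_le[OF p(1) m0, of a], where 'a = real] m(1)
      by (simp add: algebra_simps)
    also have "\<dots> \<le> (g p * (real p ^ a) powr e) * ((\<Prod>p\<in>prime_factors m. g p) * real m powr e)"
      using g[OF p(1)] g0 by (intro mult_mono IH) (auto intro: mult_nonneg_nonneg)
    also have "\<dots> = (\<Prod>p\<in>prime_factors n. g p) * real n powr e"
      unfolding pf using pn m(1) by (simp add: powr_mult)
    finally show ?thesis .
  qed
qed

text \<open>Only primes below \<open>2 powr (1 / e)\<close>, up to rounding, cost the factor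
  \<open>B\<close>; all others cost 1. There are at most \<open>P\<close> of the former, so
  \<open>B ^ P\<close> serves for every \<open>n\<close>.\<close>

lemma divisor_bound:
  fixes e :: real
  assumes "e > 0"
  obtains C :: real where "C \<ge> 1"
    "\<forall>n::nat>0. real (card {d. d dvd n}) \<le> C * real n powr e"
proof -
  define P where "P = nat \<lceil>2 powr (1 / e)\<rceil>"
  define B where "B = 1 + 1 / (e * ln 2)"
  define g where "g = (\<lambda>p. if p < P then B else 1)"
  have B: "B \<ge> 1" using assms by (simp add: B_def)
  have g: "real a + 1 \<le> g p * (real p ^ a) powr e" if "prime p" for p a :: nat
  proof (cases "p < P")
    case True
    then show ?thesis
      using Suc_le_powr_const[of e "real p" a] assms prime_ge_2_nat[OF that]
      by (simp add: g_def B_def)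
  next
    case False
    then have "2 powr (1 / e) \<le> real p"
      unfolding P_def by linarith
    then show ?thesis
      using Suc_le_powr[of e "real p" a] assms False by (simp add: g_def)
  qed
  have prod: "(\<Prod>p\<in>prime_factors n. g p) \<le> B ^ P" for n :: nat
  proof -
    have "(\<Prod>p\<in>prime_factors n. g p) = (\<Prod>p\<in>{p \<in> prime_factors n. p < P}. B)"
      unfolding g_def by (subst prod.inter_filter) auto
    also have "\<dots> = B ^ card {p \<in> prime_factors n. p < P}" by simp
    also have "card {p \<in> prime_factors n. p < P} \<le> P"
      using card_mono[of "{..<P}" "{p \<in> prime_factors n. p < P}"] by auto
    then have "B ^ card {p \<in> prime_factors n. p < P} \<le> B ^ P"
      using B by (rule power_increasing)
    finally show ?thesis .
  qed
  show thesis
  proof (rule that; (intro allI impI)?)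
    show "B ^ P \<ge> 1" using B by simp
    fix n :: nat assume "n > 0"
    then have "real (card {d. d dvd n}) \<le> (\<Prod>p\<in>prime_factors n. g p) * real n powr e"
      by (rule card_divisors_le_prod) (use g B in \<open>auto simp: g_def\<close>)
    also have "\<dots> \<le> B ^ P * real n powr e"
      by (intro mult_right_mono prod) auto
    finally show "real (card {d. d dvd n}) \<le> B ^ P * real n powr e" .
  qed
qed

section \<open>Sums of two unit fractions\<close>

text \<open>The fraction need not be in lowest terms: \<open>N\<close> will be the unreduced common
  denominator \<open>n * P\<close>.\<close>

definition binary_numerators :: "nat \<Rightarrow> nat set" where
  "binary_numerators N = {b. b > 0 \<and>
     (\<exists>x y::nat. x > 0 \<and> y > 0 \<and> (of_nat b / of_nat N :: rat) = 1 / of_nat x + 1 / of_nat y)}"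

lemma binary_numerators_subset:
  assumes "N > 0"
  shows "binary_numerators N \<subseteq>
    (\<Union>(u, v)\<in>{(u, v). u * v dvd N}. {d. d dvd N div (u * v) * (u + v)})"
proof
  fix b assume "b \<in> binary_numerators N"
  then obtain x y :: nat where xy: "x > 0" "y > 0"
    and eq: "(of_nat b / of_nat N :: rat) = 1 / of_nat x + 1 / of_nat y"
    by (auto simp: binary_numerators_def)
  from eq xy assms have "(of_nat (b * (x * y)) :: rat) = of_nat (N * (x + y))"
    by (simp add: field_simps)
  then have eqn: "b * (x * y) = N * (x + y)"
    by (simp only: of_nat_eq_iff)
  define g where "g = gcd x y"
  have g: "g > 0" using xy by (simp add: g_def)
  obtain u v where uv: "x = g * u" "y = g * v" "coprime u v"
    using gcd_coprime_exists[of x y] xy unfolding g_def by (auto simp: mult.commute)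
  have pos: "u > 0" "v > 0" using xy uv by auto
  from eqn have "g * (b * g * (u * v)) = g * (N * (u + v))"
    by (simp add: uv algebra_simps)
  with g have eq2: "b * g * (u * v) = N * (u + v)" by simp
  \<comment> \<open>A common divisor of \<open>u\<close> and \<open>u + v\<close> also divides
    \<open>v\<close>. Hence \<open>u * v\<close> is coprime to \<open>u + v\<close> and must divide
    \<open>N\<close>.\<close>
  have "coprime u (u + v)" "coprime v (u + v)"
    using uv(3) by (simp_all add: coprime_iff_gcd_eq_1 gcd.commute[of v u])
      (metis add.commute gcd.commute gcd_add1)
  then have "coprime (u * v) (u + v)" by simp
  moreover have "u * v dvd N * (u + v)" using eq2 by (metis dvd_triv_right)
  ultimately have dvd: "u * v dvd N" by (simp add: coprime_dvd_mult_left_iff)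
  then obtain q where q: "N = u * v * q" by blast
  from eq2 q have "(u * v) * (b * g) = (u * v) * (q * (u + v))" by (simp add: mult_ac)
  then have "b * g = q * (u + v)" using pos by simp
  then have "b dvd q * (u + v)" by (metis dvd_triv_left)
  moreover have "N div (u * v) = q" using q pos by simp
  ultimately show "b \<in> (\<Union>(u, v)\<in>{(u, v). u * v dvd N}. {d. d dvd N div (u * v) * (u + v)})"
    using dvd by auto
qed

text \<open>The divisor bound enters three times: for \<open>u\<close> and \<open>v\<close>, both
  divisors of \<open>N\<close>, and for \<open>b\<close>, a divisor of \<open>q * (u + v)\<close>
  where \<open>q = N div (u * v)\<close>. The last number is at most \<open>2 * N\<close> because
  \<open>u + v \<le> 2 * (u * v)\<close>, whence the factor \<open>2 powr e\<close>.\<close>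

lemma finite_binary_numerators_card_le:
  assumes C: "C \<ge> 1" "\<forall>n::nat>0. real (card {d. d dvd n}) \<le> C * real n powr e"
    and "e > 0" "N > 0"
  shows "finite (binary_numerators N)"
    and "real (card (binary_numerators N)) \<le> C ^ 3 * 2 powr e * real N powr (3 * e)"
proof -
  let ?I = "{(u, v). u * v dvd N}"
  let ?D = "\<lambda>(u, v). {d. d dvd N div (u * v) * (u + v)}"
  have sub: "?I \<subseteq> {d. d dvd N} \<times> {d. d dvd N}"
    by (auto dest: dvd_mult_left dvd_mult_right)
  have finI: "finite ?I"
    by (rule finite_subset[OF sub]) (use \<open>N > 0\<close> in auto)
  have D: "finite (?D uv) \<and> real (card (?D uv)) \<le> C * (2 * real N) powr e" if uv: "uv \<in> ?I" for uv
  proof -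
    obtain u v where [simp]: "uv = (u, v)" by (cases uv)
    from uv obtain q where q: "N = u * v * q" by auto
    with \<open>N > 0\<close> have pos: "u > 0" "v > 0" "q > 0" by auto
    have "u \<le> u * v" "v \<le> u * v" using pos by auto
    then have "u + v \<le> 2 * (u * v)" by linarith
    then have "q * (u + v) \<le> 2 * N"
      using q mult_left_mono[of "u + v" "2 * (u * v)" q] by (simp add: mult_ac)
    then have le: "real (q * (u + v)) \<le> 2 * real N"
      using of_nat_mono[of "q * (u + v)" "2 * N", where 'a = real] by simp
    have D: "?D uv = {d. d dvd q * (u + v)}" using q pos by simp
    have "real (card {d. d dvd q * (u + v)}) \<le> C * real (q * (u + v)) powr e"
      using pos by (intro C(2)[rule_format]) auto
    also have "\<dots> \<le> C * (2 * real N) powr e"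
      using le C(1) \<open>e > 0\<close> by (intro mult_left_mono powr_mono2) auto
    finally show ?thesis unfolding D using pos by auto
  qed
  have sub': "binary_numerators N \<subseteq> (\<Union>uv\<in>?I. ?D uv)"
    using binary_numerators_subset[OF \<open>N > 0\<close>] by simp
  have fin: "finite (\<Union>uv\<in>?I. ?D uv)"
    using finI D by blast
  show "finite (binary_numerators N)"
    using sub' fin by (rule finite_subset)
  have "card ?I \<le> card {d. d dvd N} * card {d. d dvd N}"
    using card_mono[OF _ sub] \<open>N > 0\<close> by (simp add: card_cartesian_product)
  then have "real (card ?I) \<le> real (card {d. d dvd N}) * real (card {d. d dvd N})"
    by (metis of_nat_mono of_nat_mult)
  also have "\<dots> \<le> (C * real N powr e) * (C * real N powr e)"
    using \<open>N > 0\<close> C by (intro mult_mono C(2)[rule_format]) auto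
  finally have I: "real (card ?I) \<le> (C * real N powr e) * (C * real N powr e)" .
  have "card (binary_numerators N) \<le> (\<Sum>uv\<in>?I. card (?D uv))"
    using card_mono[OF fin sub'] card_UN_le[OF finI, of ?D] by linarith
  then have "real (card (binary_numerators N)) \<le> (\<Sum>uv\<in>?I. real (card (?D uv)))"
    unfolding of_nat_sum[symmetric] by (rule of_nat_mono)
  also have "\<dots> \<le> (\<Sum>uv\<in>?I. C * (2 * real N) powr e)"
    using D by (intro sum_mono) blast
  also have "\<dots> = real (card ?I) * (C * (2 * real N) powr e)" by simp
  also have "\<dots> \<le> (C * real N powr e) * (C * real N powr e) * (C * (2 * real N) powr e)"
    using C by (intro mult_right_mono I) auto
  also have "\<dots> = C ^ 3 * 2 powr e * (real N powr e * real N powr e * real N powr e)"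
    by (simp add: powr_mult power3_eq_cube mult_ac)
  also have "real N powr e * real N powr e * real N powr e = real N powr (3 * e)"
    by (simp flip: powr_add)
  finally show "real (card (binary_numerators N)) \<le> C ^ 3 * 2 powr e * real N powr (3 * e)" .
qed

section \<open>Fixing the small denominators\<close>

text \<open>The full product is taken as denominator, without reduction, because its size is easy to
  control through the thresholds.\<close>

lemma sum_unit_fractions_eq_divide_prod:
  fixes f :: "'a \<Rightarrow> nat"
  assumes "finite I" "\<And>i. i \<in> I \<Longrightarrow> f i > 0"
  shows "\<exists>r::nat. (\<Sum>i\<in>I. 1 / of_nat (f i) :: rat) = of_nat r / of_nat (\<Prod>i\<in>I. f i)"
  using assms
proof (induction I rule: finite_induct)
  case empty
  show ?case by (auto intro: exI[of _ 0])
next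
  case (insert x I)
  then obtain r :: nat where r: "(\<Sum>i\<in>I. 1 / of_nat (f i) :: rat) = of_nat r / of_nat (\<Prod>i\<in>I. f i)"
    by auto
  define P where "P = (\<Prod>i\<in>I. f i)"
  have "P > 0" "f x > 0" using insert by (auto simp: P_def)
  then have "1 / of_nat (f x) + of_nat r / of_nat P = (of_nat (P + r * f x) / of_nat (f x * P) :: rat)"
    by (simp add: field_simps)
  then show ?case
    using insert.hyps r unfolding P_def by (intro exI[of _ "P + r * f x"]) (simp add: P_def)
qed

text \<open>Subtracting the fixed part \<open>r / P\<close> maps \<open>a\<close> injectively to the
  numerator \<open>a * P - n * r\<close> of a sum of two unit fractions over
  \<open>n * P\<close>.\<close>

lemma finite_card_numerators_le_binary:
  fixes n P r :: nat
  assumes "n > 0" "P > 0" "finite (binary_numerators (n * P))"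
  defines "S \<equiv> {a::nat. \<exists>x y::nat. x > 0 \<and> y > 0 \<and>
    (of_nat a / of_nat n :: rat) = of_nat r / of_nat P + (1 / of_nat x + 1 / of_nat y)}"
  shows "finite S" "card S \<le> card (binary_numerators (n * P))"
proof -
  let ?h = "\<lambda>a. a * P - n * r"
  \<comment> \<open>The strict inequality ensures that the truncated subtraction in
    \<open>?h\<close> is a genuine one; injectivity relies on it too.\<close>
  have S: "n * r < a * P \<and> ?h a \<in> binary_numerators (n * P)" if "a \<in> S" for a
  proof -
    from that obtain x y :: nat where xy: "x > 0" "y > 0"
      and eq: "(of_nat a / of_nat n :: rat) = of_nat r / of_nat P + (1 / of_nat x + 1 / of_nat y)"
      by (auto simp: S_def)
    have diff: "(of_nat (a * P) - of_nat (n * r)) / of_nat (n * P) = (1 / of_nat x + 1 / of_nat y :: rat)"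
      using eq assms(1,2) by (simp add: field_simps)
    moreover have "(1 / of_nat x + 1 / of_nat y :: rat) > 0"
      using xy by (intro add_pos_pos) auto
    ultimately have "0 < (of_nat (a * P) - of_nat (n * r) :: rat) / of_nat (n * P)" by simp
    then have "(of_nat (n * r) :: rat) < of_nat (a * P)"
      using assms(1,2) by (subst (asm) zero_less_divide_iff) (auto simp flip: of_nat_mult)
    then have lt: "n * r < a * P" by (simp only: of_nat_less_iff)
    then have "(of_nat (?h a) :: rat) = of_nat (a * P) - of_nat (n * r)"
      by (intro of_nat_diff) simp
    with diff lt xy show ?thesis
      unfolding binary_numerators_def by auto
  qed
  have inj: "inj_on ?h S"
  proof (rule inj_onI)
    fix a b assume "a \<in> S" "b \<in> S" "?h a = ?h b"
    with S[of a] S[of b] have "a * P = b * P" by linarith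
    then show "a = b" using \<open>P > 0\<close> by simp
  qed
  have im: "?h ` S \<subseteq> binary_numerators (n * P)" using S by blast
  show "finite S" using inj im assms(3) by (rule inj_on_finite)
  show "card S \<le> card (binary_numerators (n * P))" using inj im assms(3) by (rule card_inj_on_le)
qed

lemma finite_card_nat_in_interval_le:
  fixes x L :: real
  assumes "x \<ge> 0" "L \<ge> 0"
  shows "finite {a::nat. x < real a \<and> real a \<le> x + L}"
    and "real (card {a::nat. x < real a \<and> real a \<le> x + L}) \<le> L + 1"
proof -
  have sub: "{a::nat. x < real a \<and> real a \<le> x + L} \<subseteq> {nat \<lfloor>x\<rfloor><..nat \<lfloor>x + L\<rfloor>}"
    using assms by (auto simp: nat_less_iff floor_less_iff le_nat_iff le_floor_iff)
  then show "finite {a::nat. x < real a \<and> real a \<le> x + L}"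
    by (rule finite_subset) simp
  have "card {a::nat. x < real a \<and> real a \<le> x + L} \<le> nat \<lfloor>x + L\<rfloor> - nat \<lfloor>x\<rfloor>"
    using card_mono[OF _ sub] by simp
  moreover have "real (nat \<lfloor>x + L\<rfloor> - nat \<lfloor>x\<rfloor>) \<le> L + 1"
    using assms by linarith
  ultimately show "real (card {a::nat. x < real a \<and> real a \<le> x + L}) \<le> L + 1"
    by linarith
qed

section \<open>Tuples of denominators below the thresholds\<close>

text \<open>The exponents 1, 2, 4, ... add up to \<open>2 ^ (j - 1) - 1\<close>. The product of the
  thresholds before index \<open>j\<close> is thus exactly one factor \<open>T\<close> short of the
  threshold at \<open>j\<close>; this is where the saving of \<open>T\<close> comes from.\<close>

lemma prod_power_doubling:
  fixes T :: "'a :: comm_monoid_mult"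
  assumes "j \<ge> 1"
  shows "(\<Prod>i\<in>{1..<j}. T ^ 2 ^ (i - 1)) = T ^ (2 ^ (j - 1) - 1)"
  using assms
proof (induction j rule: dec_induct)
  case base
  show ?case by simp
next
  case (step j)
  have "(2::nat) ^ j = 2 ^ (j - 1) + 2 ^ (j - 1)"
    using step.hyps by (cases j) auto
  then have "(2::nat) ^ j - 1 = (2 ^ (j - 1) - 1) + 2 ^ (j - 1)"
    by simp
  then have "T ^ (2 ^ j - 1) = T ^ (2 ^ (j - 1) - 1) * T ^ 2 ^ (j - 1)"
    by (simp only: power_add)
  then show ?case
    using step by simp
qed

text \<open>The possible prefixes \<open>m_1, ..., m_{j-1}\<close>. Extensional functions are used
  so that the set is finite and its cardinality is a product.\<close>

definition bounded_tuples :: "real \<Rightarrow> nat \<Rightarrow> (nat \<Rightarrow> nat) set" where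
  "bounded_tuples T j = (\<Pi>\<^sub>E i\<in>{1..<j}. {1..nat \<lfloor>T ^ 2 ^ (i - 1)\<rfloor>})"

lemma finite_bounded_tuples: "finite (bounded_tuples T j)"
  unfolding bounded_tuples_def by (intro finite_PiE) auto

lemma card_bounded_tuples_le:
  assumes "j \<ge> 1" "T \<ge> 0"
  shows "real (card (bounded_tuples T j)) \<le> T ^ (2 ^ (j - 1) - 1)"
proof -
  have "real (card (bounded_tuples T j)) = (\<Prod>i\<in>{1..<j}. real (nat \<lfloor>T ^ 2 ^ (i - 1)\<rfloor>))"
    unfolding bounded_tuples_def by (subst card_PiE) auto
  also have "\<dots> \<le> (\<Prod>i\<in>{1..<j}. T ^ 2 ^ (i - 1))"
    using assms by (intro prod_mono) auto
  finally show ?thesis using prod_power_doubling[OF assms(1), of T] by simp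
qed

lemma bounded_tuples_pos: "f \<in> bounded_tuples T j \<Longrightarrow> i \<in> {1..<j} \<Longrightarrow> f i > 0"
  unfolding bounded_tuples_def by (drule (1) PiE_mem) auto

lemma prod_bounded_tuples_le:
  assumes "f \<in> bounded_tuples T j" "j \<ge> 1" "T \<ge> 0"
  shows "real (\<Prod>i\<in>{1..<j}. f i) \<le> T ^ (2 ^ (j - 1) - 1)"
proof -
  have "real (f i) \<le> T ^ 2 ^ (i - 1)" if "i \<in> {1..<j}" for i
  proof -
    have "f i \<le> nat \<lfloor>T ^ 2 ^ (i - 1)\<rfloor>"
      using assms(1) that by (auto simp: bounded_tuples_def PiE_iff)
    then show ?thesis
      using assms(3) by (simp add: le_nat_iff le_floor_iff)
  qed
  then have "real (\<Prod>i\<in>{1..<j}. f i) \<le> (\<Prod>i\<in>{1..<j}. T ^ 2 ^ (i - 1))"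
    unfolding of_nat_prod by (intro prod_mono) auto
  then show ?thesis using prod_power_doubling[OF assms(2), of T] by simp
qed

lemma restrict_in_bounded_tuples:
  assumes "\<And>i. i \<in> {1..<j} \<Longrightarrow> m i > 0 \<and> real (m i) \<le> T ^ 2 ^ (i - 1)" "T \<ge> 0"
  shows "restrict m {1..<j} \<in> bounded_tuples T j"
  unfolding bounded_tuples_def
  using assms by (auto simp: le_nat_iff le_floor_iff Suc_le_eq)

section \<open>Case distinction on the first denominator above its threshold\<close>

text \<open>A relaxation that keeps only size information: the tail from index \<open>j\<close> on
  has at most \<open>k\<close> terms, each positive and at most
  \<open>1 / T ^ 2 ^ (j - 1)\<close>.\<close>

definition large_tail_numerators :: "nat \<Rightarrow> nat \<Rightarrow> real \<Rightarrow> nat \<Rightarrow> (nat \<Rightarrow> nat) \<Rightarrow> nat set" where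
  "large_tail_numerators k n T j f = {a.
     real n * (\<Sum>i\<in>{1..<j}. 1 / real (f i)) < real a \<and>
     real a \<le> real n * (\<Sum>i\<in>{1..<j}. 1 / real (f i)) + real k * real n / T ^ 2 ^ (j - 1)}"

text \<open>Here the arithmetic is kept: after the prefix exactly two unit fractions remain, which
  is the situation for \<open>j = k - 1\<close>.\<close>

definition binary_tail_numerators :: "nat \<Rightarrow> nat \<Rightarrow> (nat \<Rightarrow> nat) \<Rightarrow> nat set" where
  "binary_tail_numerators n j f = {a. \<exists>x y::nat. x > 0 \<and> y > 0 \<and>
     (of_nat a / of_nat n :: rat) =
       (\<Sum>i\<in>{1..<j}. 1 / of_nat (f i)) + (1 / of_nat x + 1 / of_nat y)}"

lemma egyptian_numerators_subset:
  fixes T :: real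
  assumes "k \<ge> 2" "n \<ge> 1" "T \<ge> 1"
    and m: "\<And>i. i \<in> {1..k} \<Longrightarrow> m i > 0"
      "\<And>i j. i \<in> {1..k} \<Longrightarrow> j \<in> {1..k} \<Longrightarrow> i \<le> j \<Longrightarrow> m i \<le> m j"
    and a: "(of_nat a / of_nat n :: rat) = (\<Sum>i=1..k. 1 / of_nat (m i))"
  shows "a \<in> (\<Union>j\<in>{1..<k-1}. \<Union>f\<in>bounded_tuples T j. large_tail_numerators k n T j f) \<union>
              (\<Union>f\<in>bounded_tuples T (k-1). binary_tail_numerators n (k-1) f)"
proof (cases "\<forall>i\<in>{1..<k-1}. real (m i) \<le> T ^ 2 ^ (i - 1)")
  case True
  have "restrict m {1..<k-1} \<in> bounded_tuples T (k-1)"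
    using True m(1) assms(3) by (intro restrict_in_bounded_tuples) auto
  moreover have "{1..k} = insert (k-1) (insert k {1..<k-1})" using assms(1) by auto
  then have "(of_nat a / of_nat n :: rat) =
      (\<Sum>i\<in>{1..<k-1}. 1 / of_nat (m i)) + (1 / of_nat (m (k-1)) + 1 / of_nat (m k))"
    using a assms(1) by simp
  then have "a \<in> binary_tail_numerators n (k-1) (restrict m {1..<k-1})"
    using m(1)[of "k-1"] m(1)[of k] assms(1)
    unfolding binary_tail_numerators_def mem_Collect_eq
    by - (rule exI[of _ "m (k-1)"], rule exI[of _ "m k"], simp)
  ultimately show ?thesis by blast
next
  case False
  \<comment> \<open>Minimality places all denominators before \<open>j\<close> below their
    thresholds, so that they form a tuple in \<open>bounded_tuples T j\<close>.\<close>
  define j where "j = (LEAST j. j \<in> {1..<k-1} \<and> real (m j) > T ^ 2 ^ (j - 1))"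
  have j: "j \<in> {1..<k-1}" "real (m j) > T ^ 2 ^ (j - 1)"
    using LeastI_ex[of "\<lambda>j. j \<in> {1..<k-1} \<and> real (m j) > T ^ 2 ^ (j - 1)"] False
    unfolding j_def by force+
  have small: "real (m i) \<le> T ^ 2 ^ (i - 1)" if "i \<in> {1..<j}" for i
    using not_less_Least[of i "\<lambda>j. j \<in> {1..<k-1} \<and> real (m j) > T ^ 2 ^ (j - 1)"] that j(1)
    unfolding j_def[symmetric] by force
  have f: "restrict m {1..<j} \<in> bounded_tuples T j"
    using small m(1) j(1) assms(3) by (intro restrict_in_bounded_tuples) auto
  have "real a / real n = (\<Sum>i=1..k. 1 / real (m i))"
    using arg_cong[OF a, of "of_rat :: rat \<Rightarrow> real"] by (simp add: of_rat_divide of_rat_sum)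
  also have "{1..k} = {1..<j} \<union> {j..k}" using j(1) by auto
  also have "(\<Sum>i\<in>{1..<j} \<union> {j..k}. 1 / real (m i)) =
      (\<Sum>i\<in>{1..<j}. 1 / real (m i)) + (\<Sum>i\<in>{j..k}. 1 / real (m i))"
    by (intro sum.union_disjoint) auto
  finally have eq: "real a = real n * (\<Sum>i\<in>{1..<j}. 1 / real (m i)) +
      real n * (\<Sum>i\<in>{j..k}. 1 / real (m i))"
    using assms(2) by (simp add: field_simps)
  have pos: "(\<Sum>i\<in>{j..k}. 1 / real (m i)) > 0"
    using m(1) j(1) by (intro sum_pos) auto
  have Tj: "T ^ 2 ^ (j - 1) > 0" using assms(3) by simp
  have "1 / real (m i) \<le> 1 / T ^ 2 ^ (j - 1)" if "i \<in> {j..k}" for i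
  proof -
    \<comment> \<open>The ordering of the denominators passes the lower bound for \<open>m j\<close>
      on to the whole tail.\<close>
    have "m j \<le> m i" using m(2)[of j i] that j(1) by auto
    then have "T ^ 2 ^ (j - 1) \<le> real (m i)" using j(2) by linarith
    then show ?thesis using Tj by (intro divide_left_mono) (auto intro: mult_pos_pos)
  qed
  then have "(\<Sum>i\<in>{j..k}. 1 / real (m i)) \<le> real (card {j..k}) * (1 / T ^ 2 ^ (j - 1))"
    by (rule sum_bounded_above)
  also have "\<dots> \<le> real k * (1 / T ^ 2 ^ (j - 1))"
    using j(1) Tj by (intro mult_right_mono) auto
  finally have "real n * (\<Sum>i\<in>{j..k}. 1 / real (m i)) \<le> real n * (real k * (1 / T ^ 2 ^ (j - 1)))"
    by (intro mult_left_mono) auto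
  then have "a \<in> large_tail_numerators k n T j (restrict m {1..<j})"
    unfolding large_tail_numerators_def using eq pos assms(2) by (auto simp: mult_ac)
  with f j(1) show ?thesis by blast
qed

section \<open>Counting the numerators in the two cases\<close>

text \<open>Number of prefixes times number of integers in an interval. As the threshold is at most
  \<open>n\<close>, the extra 1 in the interval count is absorbed by replacing \<open>k\<close> with
  \<open>k + 1\<close>.\<close>

lemma card_large_tail_numerators_UN_le:
  fixes T :: real
  assumes "j \<ge> 1" "T \<ge> 1" "T ^ 2 ^ (j - 1) \<le> real n"
  shows "finite (\<Union>f\<in>bounded_tuples T j. large_tail_numerators k n T j f)"
    and "real (card (\<Union>f\<in>bounded_tuples T j. large_tail_numerators k n T j f))
      \<le> (real k + 1) * (real n / T)"
proof -
  let ?L = "real k * real n / T ^ 2 ^ (j - 1)"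
  have L: "?L \<ge> 0" using assms by simp
  have x: "real n * (\<Sum>i\<in>{1..<j}. 1 / real (f i)) \<ge> 0" for f :: "nat \<Rightarrow> nat"
    by (intro mult_nonneg_nonneg sum_nonneg) auto
  note interval = finite_card_nat_in_interval_le[OF x L, folded large_tail_numerators_def]
  show "finite (\<Union>f\<in>bounded_tuples T j. large_tail_numerators k n T j f)"
    using finite_bounded_tuples interval(1) by blast
  have "real (card (\<Union>f\<in>bounded_tuples T j. large_tail_numerators k n T j f))
      \<le> real (\<Sum>f\<in>bounded_tuples T j. card (large_tail_numerators k n T j f))"
    by (intro of_nat_mono card_UN_le finite_bounded_tuples)
  also have "\<dots> \<le> (\<Sum>f\<in>bounded_tuples T j. ?L + 1)"
    unfolding of_nat_sum by (intro sum_mono interval(2))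
  also have "\<dots> = real (card (bounded_tuples T j)) * (?L + 1)" by simp
  also have "\<dots> \<le> T ^ (2 ^ (j - 1) - 1) * ((real k + 1) * (real n / T ^ 2 ^ (j - 1)))"
  proof (intro mult_mono card_bounded_tuples_le)
    have "1 \<le> real n / T ^ 2 ^ (j - 1)" using assms by simp
    then show "?L + 1 \<le> (real k + 1) * (real n / T ^ 2 ^ (j - 1))"
      by (simp add: ring_distribs add_divide_distrib)
  qed (use assms L in auto)
  \<comment> \<open>The prefix count now cancels against the threshold up to one factor
    \<open>T\<close>, so the bound does not depend on \<open>j\<close>.\<close>
  also have "T ^ 2 ^ (j - 1) = T * T ^ (2 ^ (j - 1) - 1)"
    by (simp flip: power_Suc)
  also have "T ^ (2 ^ (j - 1) - 1) * ((real k + 1) * (real n / (T * T ^ (2 ^ (j - 1) - 1)))) =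
      (real k + 1) * (real n / T)"
    using assms(2) by simp
  finally show "real (card (\<Union>f\<in>bounded_tuples T j. large_tail_numerators k n T j f))
      \<le> (real k + 1) * (real n / T)" .
qed

text \<open>There are at most \<open>n / T\<close> prefixes. For each one the common denominator
  \<open>n * P\<close> is at most \<open>n ^ 2\<close>, which doubles the exponent
  \<open>3 * e\<close> of the two-fraction bound to \<open>6 * e\<close>.\<close>

lemma card_binary_tail_numerators_UN_le:
  fixes T :: real
  assumes C: "C \<ge> 1" "\<forall>n::nat>0. real (card {d. d dvd n}) \<le> C * real n powr e"
    and "e > 0" "j \<ge> 1" "n \<ge> 1" "T \<ge> 1" and T: "T ^ 2 ^ (j - 1) = real n"
  shows "finite (\<Union>f\<in>bounded_tuples T j. binary_tail_numerators n j f)"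
    and "real (card (\<Union>f\<in>bounded_tuples T j. binary_tail_numerators n j f))
      \<le> C ^ 3 * 2 powr e * real n powr (6 * e) * (real n / T)"
proof -
  have nT: "T ^ (2 ^ (j - 1) - 1) = real n / T"
  proof -
    have "real n = T * T ^ (2 ^ (j - 1) - 1)"
      unfolding T[symmetric] by (simp flip: power_Suc)
    then show ?thesis using \<open>T \<ge> 1\<close> by simp
  qed
  have fiber: "finite (binary_tail_numerators n j f) \<and>
      real (card (binary_tail_numerators n j f)) \<le> C ^ 3 * 2 powr e * real n powr (6 * e)"
    if f: "f \<in> bounded_tuples T j" for f
  proof -
    define P where "P = (\<Prod>i\<in>{1..<j}. f i)"
    have P: "P > 0" using bounded_tuples_pos[OF f] by (auto simp: P_def)
    obtain r :: nat where r: "(\<Sum>i\<in>{1..<j}. 1 / of_nat (f i) :: rat) = of_nat r / of_nat P"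
      using sum_unit_fractions_eq_divide_prod[of "{1..<j}" f] bounded_tuples_pos[OF f]
      unfolding P_def by blast
    have nP: "n * P > 0" using P \<open>n \<ge> 1\<close> by simp
    note bin = finite_binary_numerators_card_le[OF C \<open>e > 0\<close> nP]
    have n: "n > 0" using \<open>n \<ge> 1\<close> by simp
    \<comment> \<open>Folding with the fact \<open>r\<close> turns the quotient by \<open>P\<close>
      back into the prefix sum, so the set becomes the fibre over \<open>f\<close>.\<close>
    note fib = finite_card_numerators_le_binary[OF n P bin(1), of r,
        folded r]
    have "real P \<le> real n / T"
      using prod_bounded_tuples_le[OF f \<open>j \<ge> 1\<close>] \<open>T \<ge> 1\<close> nT by (simp add: P_def)
    also have "\<dots> \<le> real n"
      using \<open>T \<ge> 1\<close> by (simp add: divide_le_eq mult_le_cancel_left1)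
    finally have "real (n * P) \<le> real n * real n"
      by (simp add: mult_left_mono)
    then have "real (n * P) powr (3 * e) \<le> (real n * real n) powr (3 * e)"
      using \<open>e > 0\<close> by (intro powr_mono2) auto
    also have "\<dots> = real n powr (6 * e)"
      by (simp add: powr_mult flip: powr_add)
    finally have "C ^ 3 * 2 powr e * real (n * P) powr (3 * e) \<le> C ^ 3 * 2 powr e * real n powr (6 * e)"
      using C(1) by (intro mult_left_mono) auto
    then show ?thesis
      unfolding binary_tail_numerators_def using fib(2) bin(2) by (intro conjI fib(1)) linarith
  qed
  show "finite (\<Union>f\<in>bounded_tuples T j. binary_tail_numerators n j f)"
    using finite_bounded_tuples fiber by blast
  have "real (card (\<Union>f\<in>bounded_tuples T j. binary_tail_numerators n j f))
      \<le> real (\<Sum>f\<in>bounded_tuples T j. card (binary_tail_numerators n j f))"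
    by (intro of_nat_mono card_UN_le finite_bounded_tuples)
  also have "\<dots> \<le> (\<Sum>f\<in>bounded_tuples T j. C ^ 3 * 2 powr e * real n powr (6 * e))"
    unfolding of_nat_sum using fiber by (intro sum_mono) blast
  also have "\<dots> = C ^ 3 * 2 powr e * real n powr (6 * e) * real (card (bounded_tuples T j))" by simp
  also have "\<dots> \<le> C ^ 3 * 2 powr e * real n powr (6 * e) * (real n / T)"
    using card_bounded_tuples_le[OF \<open>j \<ge> 1\<close>, of T] \<open>T \<ge> 1\<close> C(1) nT
    by (intro mult_left_mono) auto
  finally show "real (card (\<Union>f\<in>bounded_tuples T j. binary_tail_numerators n j f))
      \<le> C ^ 3 * 2 powr e * real n powr (6 * e) * (real n / T)" .
qed

section \<open>Combining the cases and choosing the parameters\<close>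

text \<open>The condition on \<open>T\<close> makes the threshold at index \<open>k - 1\<close>
  equal to \<open>n\<close>, so all earlier ones are at most \<open>n\<close> and both counts apply.
  For \<open>k = 2\<close> there are no thresholds to exceed: \<open>T = n\<close>, and only the
  two-fraction case with the empty prefix occurs.\<close>

lemma egyptian_count_le:
  fixes T :: real
  assumes C: "C \<ge> 1" "\<forall>n::nat>0. real (card {d. d dvd n}) \<le> C * real n powr e"
    and "e > 0" "k \<ge> 2" "n \<ge> 1" "T \<ge> 1" and T: "T ^ 2 ^ (k - 2) = real n"
  shows "real (egyptian_count k n)
    \<le> (real k * (real k + 1) + C ^ 3 * 2 powr e * real n powr (6 * e)) * (real n / T)"
proof -
  let ?A = "\<lambda>j. \<Union>f\<in>bounded_tuples T j. large_tail_numerators k n T j f"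
  let ?B = "\<Union>f\<in>bounded_tuples T (k-1). binary_tail_numerators n (k-1) f"
  have A: "finite (?A j) \<and> real (card (?A j)) \<le> (real k + 1) * (real n / T)" if "j \<in> {1..<k-1}" for j
  proof -
    have "T ^ 2 ^ (j - 1) \<le> T ^ 2 ^ (k - 2)"
      using that \<open>T \<ge> 1\<close> by (intro power_increasing) auto
    then show ?thesis
      using card_large_tail_numerators_UN_le[of j T n k] that \<open>T \<ge> 1\<close> T by auto
  qed
  have B: "finite ?B" "real (card ?B) \<le> C ^ 3 * 2 powr e * real n powr (6 * e) * (real n / T)"
    using card_binary_tail_numerators_UN_le[OF C \<open>e > 0\<close>, of "k-1" n T] assms(4-7)
    by (auto simp: numeral_2_eq_2)
  have "egyptian_count k n \<le> card ((\<Union>j\<in>{1..<k-1}. ?A j) \<union> ?B)"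
    unfolding egyptian_count_def
  proof (intro card_mono subsetI)
    show "finite ((\<Union>j\<in>{1..<k-1}. ?A j) \<union> ?B)" using A B by blast
  qed (elim CollectE conjE exE, rule egyptian_numerators_subset, use assms in auto)
  also have "\<dots> \<le> card (\<Union>j\<in>{1..<k-1}. ?A j) + card ?B" by (rule card_Un_le)
  also have "\<dots> \<le> (\<Sum>j\<in>{1..<k-1}. card (?A j)) + card ?B"
    by (intro add_right_mono card_UN_le) auto
  finally have "real (egyptian_count k n) \<le> (\<Sum>j\<in>{1..<k-1}. real (card (?A j))) + real (card ?B)"
    unfolding of_nat_sum[symmetric] of_nat_add[symmetric] by (rule of_nat_mono)
  moreover have "(\<Sum>j\<in>{1..<k-1}. real (card (?A j))) \<le> real k * ((real k + 1) * (real n / T))"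
  proof -
    have "(\<Sum>j\<in>{1..<k-1}. real (card (?A j))) \<le> (\<Sum>j\<in>{1..<k-1}. (real k + 1) * (real n / T))"
      using A by (intro sum_mono) blast
    also have "\<dots> = real (k - 2) * ((real k + 1) * (real n / T))"
      by (simp add: numeral_2_eq_2)
    also have "\<dots> \<le> real k * ((real k + 1) * (real n / T))"
      using \<open>T \<ge> 1\<close> by (intro mult_right_mono) auto
    finally show ?thesis .
  qed
  moreover have "(real k * (real k + 1) + C ^ 3 * 2 powr e * real n powr (6 * e)) * (real n / T) =
      real k * ((real k + 1) * (real n / T)) + C ^ 3 * 2 powr e * real n powr (6 * e) * (real n / T)"
    by (simp only: distrib_right mult.assoc)
  ultimately show ?thesis using B(2) by linarith
qed

theorem mainTheorem1:
  fixes k :: nat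
  assumes "k \<ge> 2"
  shows "\<forall>\<epsilon>::real. \<epsilon> > 0 \<longrightarrow>
    (\<exists>N::nat. \<forall>n\<ge>N. n \<ge> 1 \<longrightarrow>
      real (egyptian_count k n) \<le> real n powr (1 - 1 / 2 ^ (k - 2) + \<epsilon>))"
proof (intro allI impI)
  fix \<epsilon> :: real assume eps: "\<epsilon> > 0"
  \<comment> \<open>One factor \<open>n powr (6 * e)\<close> comes from the divisor bound and a
    second one absorbs the constant \<open>K\<close>; together they give
    \<open>n powr \<epsilon>\<close>.\<close>
  define e where "e = \<epsilon> / 12"
  have e: "e > 0" using eps by (simp add: e_def)
  obtain C where C: "C \<ge> 1" "\<forall>n::nat>0. real (card {d. d dvd n}) \<le> C * real n powr e"
    using divisor_bound[OF e] by blast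
  define K where "K = real k * (real k + 1) + C ^ 3 * 2 powr e"
  have K: "K > 0"
    using C(1) unfolding K_def by (intro add_nonneg_pos mult_nonneg_nonneg mult_pos_pos) auto
  \<comment> \<open>From this point on \<open>K \<le> n powr (6 * e)\<close>.\<close>
  define N where "N = nat \<lceil>K powr (1 / (6 * e))\<rceil>"
  show "\<exists>N::nat. \<forall>n\<ge>N. n \<ge> 1 \<longrightarrow>
      real (egyptian_count k n) \<le> real n powr (1 - 1 / 2 ^ (k - 2) + \<epsilon>)"
  proof (intro exI[of _ N] allI impI)
    fix n :: nat assume nN: "n \<ge> N" and n: "n \<ge> 1"
    define T where "T = real n powr (1 / 2 ^ (k - 2))"
    have T1: "T \<ge> 1" using n by (simp add: T_def ge_one_powr_ge_zero)
    have Tn: "T ^ 2 ^ (k - 2) = real n"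
      using n by (simp add: T_def powr_realpow[symmetric] powr_powr)
    have n1: "real n powr (6 * e) \<ge> 1" using n e by (simp add: ge_one_powr_ge_zero)
    have "K powr (1 / (6 * e)) \<le> real n" using nN unfolding N_def by linarith
    then have "(K powr (1 / (6 * e))) powr (6 * e) \<le> real n powr (6 * e)"
      using e by (intro powr_mono2) auto
    then have Kn: "K \<le> real n powr (6 * e)" using e K by (simp add: powr_powr)
    have "real k * (real k + 1) + C ^ 3 * 2 powr e * real n powr (6 * e) \<le> K * real n powr (6 * e)"
      using mult_left_mono[OF n1, of "real k * (real k + 1)"] by (simp add: K_def ring_distribs)
    also have "\<dots> \<le> real n powr (6 * e) * real n powr (6 * e)"
      by (intro mult_right_mono Kn) auto
    also have "\<dots> = real n powr \<epsilon>"
      by (simp add: e_def flip: powr_add)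
    finally have "(real k * (real k + 1) + C ^ 3 * 2 powr e * real n powr (6 * e)) * (real n / T)
        \<le> real n powr \<epsilon> * (real n / T)"
      using T1 by (intro mult_right_mono) auto
    also have "\<dots> = real n powr (1 - 1 / 2 ^ (k - 2) + \<epsilon>)"
      using n by (simp add: T_def powr_diff powr_add)
    finally show "real (egyptian_count k n) \<le> real n powr (1 - 1 / 2 ^ (k - 2) + \<epsilon>)"
      using egyptian_count_le[OF C e assms n T1 Tn] by linarith
  qed
qed

end
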